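(* The Sorgenfrey line $(\mathbb{R},\tau)$ is not H-closed.
   Context: The Sorgenfrey line is the additive group $\mathbb{R}$ with the topology $\tau$ having the half-open intervals $[a,b)$, $a<b$, as a base; it is a paratopological group, i.e. a group with a topology for which the product map $G\times G\to G$ is jointly continuous. A paratopological group is H-closed if it is closed in every Hausdorff paratopological group containing it as a (paratopological) subgroup, that is, as a subgroup carrying the subspace topology. *)

theory Defs
  imports "HOL-Analysis.Analysis" "HOL-Algebra.Weak_Morphisms"
begin

section \<open>Paratopological groups and H-closedness\<close>

definition paratopological_group :: "('a, 'm) monoid_scheme \<Rightarrow> 'a topology \<Rightarrow> bool" where
  "paratopological_group G T \<longleftrightarrow>
     group G \<and> topspace T = carrier G \<and>
     continuous_map (prod_topology T T) T (\<lambda>(x, y). x \<otimes>\<^bsub>G\<^esub> y)"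

text \<open>A group containing \<open>G\<close> as a subgroup with the subspace topology is given, up to renaming of
  elements, by a homomorphism that is a topological embedding (in particular, it is injective).\<close>

definition paratopological_embedding ::
  "('a, 'm) monoid_scheme \<Rightarrow> 'a topology \<Rightarrow> ('b, 'n) monoid_scheme \<Rightarrow> 'b topology \<Rightarrow> ('a \<Rightarrow> 'b) \<Rightarrow> bool"
where
  "paratopological_embedding G T H S e \<longleftrightarrow> e \<in> hom G H \<and> embedding_map T S e"

text \<open>A definition in HOL cannot quantify over all types, so the ambient groups \<open>H\<close> are taken over
  one type. The elements of this type are the words in letters from \<open>G\<close>, one further letter and its
  formal inverse, which is large enough to make the choice immaterial: by the lemma
  \<open>H_closed_closedin\<close> below, an H-closed \<open>G\<close> is closed in the Hausdorff paratopological groups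
  over every type.\<close>

definition H_closed :: "('a, 'm) monoid_scheme \<Rightarrow> 'a topology \<Rightarrow> bool" where
  "H_closed G T \<longleftrightarrow>
     (\<forall>(H :: ('a + bool) list monoid) S e.
        paratopological_group H S \<and> Hausdorff_space S \<and> paratopological_embedding G T H S e
        \<longrightarrow> closedin S (e ` carrier G))"

lemma paratopological_group_subgroup:
  assumes H: "paratopological_group H S" and K: "subgroup K H"
  shows "paratopological_group (H\<lparr>carrier := K\<rparr>) (subtopology S K)"
proof -
  interpret group H using H by (simp add: paratopological_group_def)
  have KH: "K \<subseteq> carrier H" using K by (rule subgroup.subset)
  have "continuous_map (subtopology (prod_topology S S) (K \<times> K)) (subtopology S K)
          (\<lambda>(x, y). x \<otimes>\<^bsub>H\<^esub> y)"
    using H K by (auto simp: continuous_map_in_subtopology paratopological_group_def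
        continuous_map_from_subtopology subgroup.m_closed)
  then show ?thesis
    using H K KH by (auto simp: paratopological_group_def subgroup_imp_group
        subtopology_Times inf.absorb2)
qed

lemma paratopological_group_transport:
  fixes H :: "('b, 'n) monoid_scheme" and f :: "'b \<Rightarrow> 'c"
  assumes H: "paratopological_group H S" and inj: "inj_on f (carrier H)"
  obtains S' where "paratopological_group (image_group f H) S'" "homeomorphic_map S S' f"
proof -
  interpret group H using H by (simp add: paratopological_group_def)
  define h where "h = inv_into (carrier H) f"
  define S' where "S' = pullback_topology (f ` carrier H) h S"
  have top: "topspace S = carrier H" using H by (simp add: paratopological_group_def)
  have hf: "h (f x) = x" if "x \<in> carrier H" for x using that inj by (simp add: h_def)
  have top': "topspace S' = f ` carrier H"
    using top hf by (auto simp: S'_def topspace_pullback_topology)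
  have cf: "continuous_map S S' f"
    unfolding S'_def
  proof (rule continuous_map_pullback')
    show "continuous_map S S (h \<circ> f)"
      by (rule continuous_map_eq[OF continuous_map_id]) (auto simp: top hf)
  qed (use top in auto)
  have ch: "continuous_map S' S h"
    using continuous_map_pullback[OF continuous_map_id[of S], of "f ` carrier H" h]
    by (simp add: S'_def)
  have hom: "homeomorphic_map S S' f"
    unfolding homeomorphic_map_maps homeomorphic_maps_def
    using cf ch hf top top' by (intro exI[of _ h]) auto
  have "continuous_map (prod_topology S' S') (prod_topology S S) (\<lambda>p. (h (fst p), h (snd p)))"
    by (intro continuous_map_pairedI continuous_map_compose[OF continuous_map_fst ch, unfolded o_def]
        continuous_map_compose[OF continuous_map_snd ch, unfolded o_def])
  moreover have "continuous_map (prod_topology S S) S (\<lambda>(x, y). x \<otimes>\<^bsub>H\<^esub> y)"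
    using H by (simp add: paratopological_group_def)
  ultimately have "continuous_map (prod_topology S' S') S'
      (f \<circ> ((\<lambda>(x, y). x \<otimes>\<^bsub>H\<^esub> y) \<circ> (\<lambda>p. (h (fst p), h (snd p)))))"
    by (intro continuous_map_compose[OF _ cf] continuous_map_compose)
  then have "continuous_map (prod_topology S' S') S' (\<lambda>(x, y). x \<otimes>\<^bsub>image_group f H\<^esub> y)"
    by (simp add: o_def image_group_def h_def case_prod_unfold)
  then have "paratopological_group (image_group f H) S'"
    using inj_imp_image_group_is_group[OF inj] top'
    by (simp add: paratopological_group_def image_group_carrier)
  then show ?thesis using hom that by blast
qed

lemma H_closed_closedin:
  fixes H :: "('b, 'n) monoid_scheme"
  assumes G: "paratopological_group G T" and cl: "H_closed G T"
    and H: "paratopological_group H S" and haus: "Hausdorff_space S"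
    and emb: "paratopological_embedding G T H S e"
  shows "closedin S (e ` carrier G)"
proof -
  interpret group H using H by (simp add: paratopological_group_def)
  interpret e: group_hom G H e
    using G emb is_group by (auto simp: group_hom_def group_hom_axioms_def paratopological_group_def
        paratopological_embedding_def)
  have topT: "topspace T = carrier G" and topS: "topspace S = carrier H"
    using G H by (auto simp: paratopological_group_def)
  have "x \<in> e ` carrier G" if x: "x \<in> Abstract_Topology.closure_of S (e ` carrier G)" for x
  proof -
    have xH: "x \<in> carrier H"
      using x closure_of_subset_topspace topS by (metis subsetD)
    define letter where
      "letter = (\<lambda>l :: 'a + bool. case l of Inl g \<Rightarrow> e g | Inr b \<Rightarrow> if b then x else inv\<^bsub>H\<^esub> x)"
    define val where "val = (\<lambda>w. foldr (\<lambda>l y. letter l \<otimes>\<^bsub>H\<^esub> y) w \<one>\<^bsub>H\<^esub>)"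
    define W where "W = lists (Inl ` carrier G \<union> range (Inr :: bool \<Rightarrow> 'a + bool))"
    define K where "K = val ` W"
    have letter: "letter l \<in> carrier H" if "l \<in> Inl ` carrier G \<union> range Inr" for l
      using that xH by (auto simp: letter_def)
    have val: "val w \<in> carrier H" if "w \<in> W" for w
      using that unfolding W_def by (induction w) (auto simp: val_def letter)
    have val_append: "val (u @ v) = val u \<otimes>\<^bsub>H\<^esub> val v" if "u \<in> W" "v \<in> W" for u v
      using that(1) unfolding W_def
    proof (induction u)
      case Nil
      then show ?case using val[OF that(2)] by (simp add: val_def)
    next
      case (Cons l u)
      have "letter l \<in> carrier H" using Cons.hyps(1) by (rule letter)
      moreover have "val u \<in> carrier H" using Cons.hyps(2) val by (simp add: W_def)
      moreover have "val (l # w) = letter l \<otimes>\<^bsub>H\<^esub> val w" for w by (simp add: val_def)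
      ultimately show ?case using Cons.IH val[OF that(2)] by (simp add: m_assoc)
    qed
    have gK: "e g \<in> K" if "g \<in> carrier G" for g
    proof -
      have "val [Inl g] = e g" using that by (simp add: val_def letter_def)
      moreover have "[Inl g] \<in> W" using that by (simp add: W_def)
      ultimately show ?thesis unfolding K_def by (metis imageI)
    qed
    have bK: "(if b then x else inv\<^bsub>H\<^esub> x) \<in> K" for b
    proof -
      have "val [Inr b] = (if b then x else inv\<^bsub>H\<^esub> x)" using xH by (simp add: val_def letter_def)
      moreover have "[Inr b] \<in> W" by (simp add: W_def)
      ultimately show ?thesis unfolding K_def by (metis imageI)
    qed
    have mK: "a \<otimes>\<^bsub>H\<^esub> b \<in> K" if "a \<in> K" "b \<in> K" for a b
    proof -
      obtain u v where "u \<in> W" "v \<in> W" "a = val u" "b = val v"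
        using \<open>a \<in> K\<close> \<open>b \<in> K\<close> unfolding K_def by blast
      then have "a \<otimes>\<^bsub>H\<^esub> b = val (u @ v)" "u @ v \<in> W"
        using val_append by (simp_all add: W_def)
      then show ?thesis unfolding K_def by blast
    qed
    have oneK: "\<one>\<^bsub>H\<^esub> \<in> K"
      unfolding K_def by (rule image_eqI[of _ _ "[]"]) (auto simp: val_def W_def)
    have KH: "K \<subseteq> carrier H" using val by (auto simp: K_def)
    have inv_letter: "inv\<^bsub>H\<^esub> (letter l) \<in> K" if "l \<in> Inl ` carrier G \<union> range Inr" for l
    proof (cases l)
      case (Inl g)
      then have "g \<in> carrier G" using that by auto
      then show ?thesis using gK[of "inv\<^bsub>G\<^esub> g"] Inl by (simp add: letter_def)
    next
      case (Inr b)
      then show ?thesis using bK[of "\<not> b"] xH by (auto simp: letter_def split: if_splits)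
    qed
    have inv_val: "inv\<^bsub>H\<^esub> (val w) \<in> K" if "w \<in> W" for w
      using that unfolding W_def
    proof (induction w)
      case Nil
      then show ?case using oneK by (simp add: val_def)
    next
      case (Cons l w)
      have "val w \<in> carrier H" using Cons.hyps(2) val by (simp add: W_def)
      then have "inv\<^bsub>H\<^esub> (val (l # w)) = inv\<^bsub>H\<^esub> (val w) \<otimes>\<^bsub>H\<^esub> inv\<^bsub>H\<^esub> (letter l)"
        using letter[OF Cons.hyps(1)] by (simp add: val_def inv_mult_group)
      then show ?case using mK[OF Cons.IH inv_letter[OF Cons.hyps(1)]] by simp
    qed
    have K: "subgroup K H"
      by (rule subgroupI) (use KH oneK mK inv_val in \<open>auto simp: K_def\<close>)
    define r where "r = inv_into W val"
    let ?HK = "H\<lparr>carrier := K\<rparr>" and ?SK = "subtopology S K"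
    have injr: "inj_on r (carrier ?HK)" by (simp add: r_def K_def inj_on_inv_into)
    obtain S' where H': "paratopological_group (image_group r ?HK) S'"
      and hr: "homeomorphic_map ?SK S' r"
      using paratopological_group_transport[OF paratopological_group_subgroup[OF H K] injr] by blast
    have eK: "e ` carrier G \<subseteq> K" using gK by blast
    have "embedding_map T ?SK e"
      using emb eK topT by (simp add: embedding_map_in_subtopology paratopological_embedding_def)
    then have "embedding_map T S' (r \<circ> e)"
      using hr embedding_map_compose surjective_embedding_map by blast
    moreover have "r \<circ> e \<in> hom G (image_group r ?HK)"
    proof (rule Group.hom_compose)
      show "e \<in> hom G ?HK" using eK e.homh by (auto simp: hom_def)
      show "r \<in> hom ?HK (image_group r ?HK)"
        using inj_imp_image_group_iso[OF injr] by (simp add: iso_def)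
    qed
    moreover have "Hausdorff_space S'"
      using haus hr Hausdorff_space_subtopology homeomorphic_Hausdorff_space
        homeomorphic_map_imp_homeomorphic_space by metis
    ultimately have "closedin S' ((r \<circ> e) ` carrier G)"
      using cl H' unfolding H_closed_def paratopological_embedding_def by blast
    then have "closedin ?SK (e ` carrier G)"
      using homeomorphic_map_closedness[OF hr, of "e ` carrier G"] eK KH topS
      by (simp add: image_comp inf.absorb2)
    then obtain C where "closedin S C" "e ` carrier G = C \<inter> K"
      by (auto simp: closedin_subtopology)
    moreover from this have "x \<in> C" using x closure_of_minimal by (metis inf_le1 subsetD)
    moreover have "x \<in> K" using bK[of True] by simp
    ultimately show ?thesis by blast
  qed
  then have "Abstract_Topology.closure_of S (e ` carrier G) \<subseteq> e ` carrier G" by blast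
  moreover have "e ` carrier G \<subseteq> topspace S" using topS e.hom_closed by blast
  ultimately show ?thesis using closure_of_subset_eq by blast
qed

section \<open>The Sorgenfrey line\<close>

definition real_add_group :: "real monoid" where
  "real_add_group = \<lparr>carrier = UNIV, monoid.mult = (+), one = 0\<rparr>"

definition sorgenfrey :: "real topology" where
  "sorgenfrey = topology (arbitrary union_of (\<lambda>U. \<exists>a b. a < b \<and> U = {a..<b}))"

lemma openin_sorgenfrey:
  "openin sorgenfrey = arbitrary union_of (\<lambda>U. \<exists>a b. a < b \<and> U = {a..<b})"
  unfolding sorgenfrey_def
proof (rule topology_inverse', unfold istopology_base_eq, clarify)
  fix a b c d :: real
  show "(arbitrary union_of (\<lambda>U. \<exists>a b. a < b \<and> U = {a..<b})) ({a..<b} \<inter> {c..<d})"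
    unfolding arbitrary_union_of_alt
  proof
    fix x assume "x \<in> {a..<b} \<inter> {c..<d}"
    then show "\<exists>U. (\<exists>a b. a < b \<and> U = {a..<b}) \<and> x \<in> U \<and> U \<subseteq> {a..<b} \<inter> {c..<d}"
      by (intro exI[of _ "{x..<min b d}"] conjI exI[of _ x] exI[of _ "min b d"]) auto
  qed
qed

lemma openin_sorgenfrey_iff:
  "openin sorgenfrey U \<longleftrightarrow> (\<forall>x\<in>U. \<exists>y>x. {x..<y} \<subseteq> U)"
proof
  assume "openin sorgenfrey U"
  show "\<forall>x\<in>U. \<exists>y>x. {x..<y} \<subseteq> U"
  proof
    fix x assume "x \<in> U"
    then obtain a b where "x \<in> {a..<b}" "{a..<b} \<subseteq> U"
      using \<open>openin sorgenfrey U\<close> unfolding openin_sorgenfrey arbitrary_union_of_alt by blast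
    then show "\<exists>y>x. {x..<y} \<subseteq> U" by (intro exI[of _ b]) auto
  qed
next
  assume "\<forall>x\<in>U. \<exists>y>x. {x..<y} \<subseteq> U"
  then show "openin sorgenfrey U"
    unfolding openin_sorgenfrey arbitrary_union_of_alt
    by (metis atLeastLessThan_iff order_refl)
qed

lemma topspace_sorgenfrey [simp]: "topspace sorgenfrey = UNIV"
proof -
  have "openin sorgenfrey UNIV"
    unfolding openin_sorgenfrey_iff using gt_ex by auto
  then show ?thesis using openin_subset by blast
qed

lemma paratopological_group_sorgenfrey: "paratopological_group real_add_group sorgenfrey"
proof -
  have "group real_add_group"
    unfolding real_add_group_def by (rule groupI; simp) (metis add.left_inverse)
  moreover have "continuous_map (prod_topology sorgenfrey sorgenfrey) sorgenfrey (\<lambda>(x, y). x + y)"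
    unfolding continuous_map_def
  proof (intro conjI allI impI)
    fix U assume U: "openin sorgenfrey U"
    show "openin (prod_topology sorgenfrey sorgenfrey)
            {p \<in> topspace (prod_topology sorgenfrey sorgenfrey). (case p of (x, y) \<Rightarrow> x + y) \<in> U}"
      unfolding openin_prod_topology_alt
    proof (intro allI impI)
      fix x y
      assume "(x, y) \<in> {p \<in> topspace (prod_topology sorgenfrey sorgenfrey).
                          (case p of (x, y) \<Rightarrow> x + y) \<in> U}"
      then obtain z where z: "z > x + y" "{x + y..<z} \<subseteq> U"
        using U unfolding openin_sorgenfrey_iff by auto
      define d where "d = (z - (x + y)) / 2"
      have "openin sorgenfrey {t..<t + d}" for t
        unfolding openin_sorgenfrey_iff by (metis atLeastLessThan_iff ivl_subset order_refl)
      moreover have "x' + y' \<in> U" if "x' \<in> {x..<x + d}" "y' \<in> {y..<y + d}" for x' y'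
        using that z(2) by (intro subsetD[OF z(2)]) (auto simp: d_def field_simps)
      moreover have "d > 0" using z(1) by (simp add: d_def)
      ultimately show "\<exists>A B. openin sorgenfrey A \<and> openin sorgenfrey B \<and> x \<in> A \<and> y \<in> B \<and>
          A \<times> B \<subseteq> {p \<in> topspace (prod_topology sorgenfrey sorgenfrey).
                          (case p of (x, y) \<Rightarrow> x + y) \<in> U}"
        by (intro exI[of _ "{x..<x + d}"] exI[of _ "{y..<y + d}"]) auto
    qed
  qed auto
  ultimately show ?thesis
    by (simp add: paratopological_group_def real_add_group_def)
qed

end

theory Submission
  imports Defs "HOL-Library.Multiset" "HOL-Number_Theory.Cong"
begin

text \<open>Adjoin to the line a free generator, which gives \<open>\<real> \<times> \<int>\<close>, and force the points
  \<open>p m = (2 ^ (m\<^sup>2), 1)\<close> to tend to \<open>0\<close>: a neighbourhood of \<open>0\<close> consists of the sums of some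
  \<open>(s, 0)\<close> with \<open>s \<ge> 0\<close> and finitely many (with repetitions) points \<open>p m\<close>, where \<open>(s, 0)\<close> costs \<open>s\<close>,
  each \<open>p m\<close> costs \<open>(1/2) ^ m\<close>, and the total cost is less than \<open>\<epsilon>\<close>. Then \<open>p m + (0, -1)\<close> is a
  sequence in the line that tends to \<open>(0, -1)\<close>, so the line is not closed. Cheap sums use \<open>p m\<close>
  fewer than \<open>2 ^ m\<close> times, and \<open>2 ^ (m\<^sup>2)\<close> grows fast enough for the part in the \<open>p m\<close> to be
  determined by its first coordinate, distinct values of which lie far apart; this makes the
  topology Hausdorff.\<close>

section \<open>Spikes, their costs and uniqueness of cheap sums\<close>

definition spike :: "nat \<Rightarrow> nat" where
  "spike m = 2 ^ (m\<^sup>2)"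

definition cost :: "nat multiset \<Rightarrow> real" where
  "cost M = (\<Sum>m\<in>#M. (1/2) ^ m)"

lemma cost_simps [simp]:
  "cost {#} = 0" "cost (add_mset m M) = (1/2) ^ m + cost M" "cost (M + N) = cost M + cost N"
  by (simp_all add: cost_def)

lemma cost_nonneg: "0 \<le> cost M"
  by (induction M) auto

lemma count_le_cost: "real (count M m) * (1/2) ^ m \<le> cost M"
proof (induction M)
  case (add x M)
  have "0 \<le> (1/2 :: real) ^ x" by simp
  with add show ?case by (cases "x = m") (simp_all add: distrib_right add_increasing)
qed simp

lemma count_less_if_cost:
  assumes "cost M < 1"
  shows "count M m < 2 ^ m"
proof -
  have "real (count M m) * (1/2) ^ m < 1"
    using count_le_cost[of M m] assms by linarith
  then have "real (count M m) < real (2 ^ m)"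
    by (simp add: power_divide field_simps)
  then show ?thesis by (simp only: of_nat_less_iff)
qed

text \<open>A single occurrence of \<open>m\<close> already costs \<open>(1/2) ^ m\<close>. With
  \<open>spike_dvd_sum\<close>, a multiset cheaper than \<open>(1/2) ^ n\<close> therefore has a
  spike sum divisible by \<open>spike n\<close>.\<close>

lemma less_if_cost:
  assumes "cost M < (1/2) ^ n" "m \<in># M"
  shows "n < m"
proof -
  have "1 * (1/2) ^ m \<le> real (count M m) * (1/2) ^ m"
    using assms(2) by (intro mult_right_mono) (auto simp: Suc_le_eq)
  then have "(1/2 :: real) ^ m < (1/2) ^ n"
    using count_le_cost[of M m] assms(1) by linarith
  then show ?thesis by (subst (asm) power_strict_decreasing_iff) auto
qed

lemma spike_dvd: "m \<le> n \<Longrightarrow> spike m dvd spike n"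
  by (simp add: spike_def le_imp_power_dvd)

lemma spike_dvd_sum:
  assumes "\<And>m. m \<in># M \<Longrightarrow> n \<le> m"
  shows "spike n dvd (\<Sum>m\<in>#M. spike m)"
  using assms by (induction M) (auto intro!: dvd_add spike_dvd)

lemma le_spike: "n \<le> spike n"
proof -
  have "n \<le> n\<^sup>2" by (simp add: power2_eq_square)
  also have "\<dots> < 2 ^ (n\<^sup>2)" by (rule less_exp)
  finally show ?thesis by (simp add: spike_def)
qed

text \<open>The quadratic exponent pays off here, through
  \<open>m + m\<^sup>2 \<le> (Suc m)\<^sup>2\<close>. Multiplicities below \<open>2 ^ m\<close> thus
  behave like admissible digits in a mixed radix system.\<close>

lemma mult_spike_less:
  assumes "c < 2 ^ m"
  shows "c * spike m < spike (Suc m)"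
proof -
  have "c * spike m < 2 ^ m * spike m" using assms by (simp add: spike_def)
  also have "\<dots> = 2 ^ (m + m\<^sup>2)" by (simp add: spike_def power_add)
  also have "\<dots> \<le> spike (Suc m)"
    unfolding spike_def by (rule power_increasing) (auto simp: power2_eq_square)
  finally show ?thesis .
qed

lemma sum_mset_split:
  fixes f :: "nat \<Rightarrow> nat"
  shows "(\<Sum>i\<in>#M. f i) =
    (\<Sum>i\<in>#filter_mset (\<lambda>i. i < m) M. f i) + count M m * f m + (\<Sum>i\<in>#filter_mset (\<lambda>i. m < i) M. f i)"
  by (induction M) (auto simp: algebra_simps)

text \<open>Multiplicities are read off like digits, from the lowest index up: modulo
  \<open>spike (Suc m)\<close> the indices above \<open>m\<close> vanish, and those below
  \<open>m\<close> contribute equally by induction.\<close>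

lemma sum_spike_inj:
  assumes M: "\<And>m. count M m < 2 ^ m" and N: "\<And>m. count N m < 2 ^ m"
    and eq: "(\<Sum>m\<in>#M. spike m) = (\<Sum>m\<in>#N. spike m)"
  shows "M = N"
proof (rule multiset_eqI)
  fix m
  show "count M m = count N m"
  proof (induction m rule: less_induct)
    case (less m)
    let ?low = "\<lambda>M. \<Sum>i\<in>#filter_mset (\<lambda>i. i < m) M. spike i"
    let ?high = "\<lambda>M. \<Sum>i\<in>#filter_mset (\<lambda>i. m < i) M. spike i"
    have mod: "[(\<Sum>i\<in>#K. spike i) = ?low K + count K m * spike m] (mod spike (Suc m))" for K
    proof -
      have "spike (Suc m) dvd ?high K" by (rule spike_dvd_sum) auto
      then have "[?low K + count K m * spike m + ?high K = ?low K + count K m * spike m + 0]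
          (mod spike (Suc m))"
        by (intro cong_add cong_refl) (simp add: cong_0_iff)
      then show ?thesis using sum_mset_split[of spike K m] by simp
    qed
    have low: "filter_mset (\<lambda>i. i < m) M = filter_mset (\<lambda>i. i < m) N"
      using less by (intro multiset_eqI) auto
    have "[?low M + count M m * spike m = ?low N + count N m * spike m] (mod spike (Suc m))"
      using cong_trans[OF cong_sym[OF mod[of M]]] mod[of N] unfolding eq by blast
    then have "[count M m * spike m = count N m * spike m] (mod spike (Suc m))"
      unfolding low by (simp only: cong_add_lcancel_nat)
    \<comment> \<open>By \<open>mult_spike_less\<close> both sides are smaller than the modulus, so
      congruence becomes equality.\<close>
    then have "count M m * spike m = count N m * spike m"
      by (rule cong_less_modulus_unique_nat) (auto intro: mult_spike_less M N)
    then show ?case by (simp add: spike_def)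
  qed
qed

section \<open>Neighbourhoods of zero in the extended group\<close>

definition ext_group :: "(real \<times> int) monoid" where
  "ext_group = \<lparr>carrier = UNIV, monoid.mult = (+), one = 0\<rparr>"

definition nbh :: "real \<Rightarrow> (real \<times> int) set" where
  "nbh \<epsilon> = {(s + real (\<Sum>m\<in>#M. spike m), int (size M)) | s M. 0 \<le> s \<and> s + cost M < \<epsilon>}"

lemma nbhI: "0 \<le> s \<Longrightarrow> s + cost M < \<epsilon> \<Longrightarrow> (s + real (\<Sum>m\<in>#M. spike m), int (size M)) \<in> nbh \<epsilon>"
  unfolding nbh_def by blast

lemma nbhE:
  assumes "u \<in> nbh \<epsilon>"
  obtains s M where "0 \<le> s" "s + cost M < \<epsilon>" "u = (s + real (\<Sum>m\<in>#M. spike m), int (size M))"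
  using assms unfolding nbh_def by blast

lemma nbh_mono: "\<epsilon> \<le> \<delta> \<Longrightarrow> nbh \<epsilon> \<subseteq> nbh \<delta>"
  unfolding nbh_def by fastforce

lemma zero_in_nbh: "0 < \<epsilon> \<Longrightarrow> 0 \<in> nbh \<epsilon>"
  using nbhI[of 0 "{#}" \<epsilon>] by (simp add: zero_prod_def)

lemma nbh_add:
  assumes "u \<in> nbh \<epsilon>" "v \<in> nbh \<delta>"
  shows "u + v \<in> nbh (\<epsilon> + \<delta>)"
proof -
  obtain s M where u: "0 \<le> s" "s + cost M < \<epsilon>" "u = (s + real (\<Sum>m\<in>#M. spike m), int (size M))"
    using assms(1) by (rule nbhE)
  obtain t N where v: "0 \<le> t" "t + cost N < \<delta>" "v = (t + real (\<Sum>m\<in>#N. spike m), int (size N))"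
    using assms(2) by (rule nbhE)
  show ?thesis using nbhI[of "s + t" "M + N" "\<epsilon> + \<delta>"] u v by (simp add: algebra_simps)
qed

lemma nbh_interior:
  assumes "u \<in> nbh \<epsilon>"
  shows "\<exists>\<delta>>0. \<forall>v\<in>nbh \<delta>. u + v \<in> nbh \<epsilon>"
proof -
  obtain s M where u: "0 \<le> s" "s + cost M < \<epsilon>" "u = (s + real (\<Sum>m\<in>#M. spike m), int (size M))"
    using assms by (rule nbhE)
  \<comment> \<open>Only half of the unspent budget is given away: costs are strictly below the
    bound, so \<open>u\<close> still fits into \<open>nbh (\<epsilon> - \<delta>)\<close>.\<close>
  define \<delta> where "\<delta> = (\<epsilon> - (s + cost M)) / 2"
  have "u \<in> nbh (\<epsilon> - \<delta>)" unfolding u(3) using u by (intro nbhI) (auto simp: \<delta>_def field_simps)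
  then have "\<forall>v\<in>nbh \<delta>. u + v \<in> nbh \<epsilon>" using nbh_add[of u "\<epsilon> - \<delta>"] by fastforce
  moreover have "\<delta> > 0" using u by (simp add: \<delta>_def)
  ultimately show ?thesis by blast
qed

text \<open>A multiset of size 0 is empty, so the trace on the line is a basic Sorgenfrey
  neighbourhood. Both directions of the embedding rest on this.\<close>

lemma nbh_level_zero: "(t, 0) \<in> nbh \<epsilon> \<longleftrightarrow> 0 \<le> t \<and> t < \<epsilon>"
proof
  assume "(t, 0) \<in> nbh \<epsilon>"
  then show "0 \<le> t \<and> t < \<epsilon>" by (rule nbhE) auto
next
  assume "0 \<le> t \<and> t < \<epsilon>"
  then show "(t, 0) \<in> nbh \<epsilon>" using nbhI[of t "{#}" \<epsilon>] by simp
qed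

lemma spike_in_nbh: "(1/2) ^ m < \<epsilon> \<Longrightarrow> (real (spike m), 1) \<in> nbh \<epsilon>"
  using nbhI[of 0 "{#m#}" \<epsilon>] by simp

text \<open>In a difference of two cheap elements, the integer part \<open>D\<close> is divisible by
  \<open>spike n\<close> yet smaller than it, hence 0. The multisets then coincide and cancel,
  leaving \<open>(s - r, 0)\<close>, which is too short to be a nonzero \<open>p\<close>.\<close>

lemma nbh_separates:
  assumes "p \<noteq> 0"
  shows "\<exists>\<epsilon>>0. \<forall>u\<in>nbh \<epsilon>. \<forall>v\<in>nbh \<epsilon>. p \<noteq> u - v"
proof -
  obtain t l where p: "p = (t, l)" by fastforce
  have "\<forall>\<^sub>F n in sequentially. \<bar>t\<bar> + 1 < real n"
    using eventually_gt_at_top filterlim_real_sequentially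
    unfolding filterlim_iff by blast
  moreover have "\<forall>\<^sub>F n in sequentially. t \<noteq> 0 \<longrightarrow> (1/2) ^ n < \<bar>t\<bar>"
    using order_tendstoD(2)[OF LIMSEQ_realpow_zero[of "1/2 :: real"], of "\<bar>t\<bar>"]
    by (cases "t = 0") auto
  \<comment> \<open>The first bound will keep \<open>D\<close> below \<open>spike n\<close>; the
    second excludes \<open>t = s - r\<close> once \<open>D\<close> is 0.\<close>
  ultimately obtain n where n: "\<bar>t\<bar> + 1 < real n" "t \<noteq> 0 \<Longrightarrow> (1/2) ^ n < \<bar>t\<bar>"
    using eventually_happens'[OF sequentially_bot eventually_conj] by blast
  define \<epsilon> :: real where "\<epsilon> = (1/2) ^ n"
  have \<epsilon>: "0 < \<epsilon>" "\<epsilon> \<le> 1" by (auto simp: \<epsilon>_def power_le_one)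
  have "p \<noteq> u - v" if uv: "u \<in> nbh \<epsilon>" "v \<in> nbh \<epsilon>" for u v
  proof
    assume puv: "p = u - v"
    obtain s M where u: "0 \<le> s" "s + cost M < \<epsilon>" "u = (s + real (\<Sum>m\<in>#M. spike m), int (size M))"
      using uv(1) by (rule nbhE)
    obtain r N where v: "0 \<le> r" "r + cost N < \<epsilon>" "v = (r + real (\<Sum>m\<in>#N. spike m), int (size N))"
      using uv(2) by (rule nbhE)
    define D where "D = int (\<Sum>m\<in>#M. spike m) - int (\<Sum>m\<in>#N. spike m)"
    have t: "t = s - r + of_int D" and l: "l = int (size M) - int (size N)"
      using puv unfolding p u(3) v(3) D_def by (auto simp del: of_nat_sum_mset)
    have cost: "cost M < \<epsilon>" "cost N < \<epsilon>" using u v by auto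
    have sr: "\<bar>s - r\<bar> < \<epsilon>" using u v cost_nonneg[of M] cost_nonneg[of N] by auto
    have "spike n dvd (\<Sum>m\<in>#M. spike m)" "spike n dvd (\<Sum>m\<in>#N. spike m)"
      using cost less_if_cost unfolding \<epsilon>_def by (auto intro!: spike_dvd_sum less_imp_le)
    then have "int (spike n) dvd D" unfolding D_def
      by (intro dvd_diff) (simp_all only: int_dvd_int_iff)
    \<comment> \<open>The absolute value of \<open>D\<close> is at most that of \<open>t\<close>
      plus that of \<open>s - r\<close>, and the latter is below 1.\<close>
    moreover have "\<bar>D\<bar> < int (spike n)"
    proof -
      have "real_of_int \<bar>D\<bar> < real n" using t sr \<epsilon> n(1) by auto
      then show ?thesis using le_spike[of n] by linarith
    qed
    ultimately have "D = 0" using dvd_imp_le_int[of D "int (spike n)"] by force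
    then have "M = N"
      using cost \<epsilon> by (intro sum_spike_inj count_less_if_cost)
        (auto simp: D_def simp del: of_nat_sum_mset)
    \<comment> \<open>Equal multisets have equal size, so \<open>l\<close> is 0 and only
      \<open>t\<close> can make \<open>p\<close> nonzero.\<close>
    then have "t \<noteq> 0" using assms p l by (auto simp: zero_prod_def)
    then show False using n(2) t sr \<open>D = 0\<close> by (auto simp: \<epsilon>_def)
  qed
  then show ?thesis using \<epsilon> by blast
qed

section \<open>The Hausdorff group topology\<close>

definition ext_top :: "(real \<times> int) topology" where
  "ext_top = topology (\<lambda>V. \<forall>x\<in>V. \<exists>\<epsilon>>0. \<forall>u\<in>nbh \<epsilon>. x + u \<in> V)"

lemma openin_ext_top: "openin ext_top V \<longleftrightarrow> (\<forall>x\<in>V. \<exists>\<epsilon>>0. \<forall>u\<in>nbh \<epsilon>. x + u \<in> V)"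
proof -
  have "istopology (\<lambda>V. \<forall>x\<in>V. \<exists>\<epsilon>>0. \<forall>u\<in>nbh \<epsilon>. x + u \<in> V)"
    unfolding istopology_def
  proof (intro conjI allI impI ballI)
    fix V W x
    assume V: "\<forall>x\<in>V. \<exists>\<epsilon>>0. \<forall>u\<in>nbh \<epsilon>. x + u \<in> V"
      and W: "\<forall>x\<in>W. \<exists>\<epsilon>>0. \<forall>u\<in>nbh \<epsilon>. x + u \<in> W" and x: "x \<in> V \<inter> W"
    obtain \<epsilon> where "\<epsilon> > 0" "\<forall>u\<in>nbh \<epsilon>. x + u \<in> V"
      using bspec[OF V, of x] x by auto
    moreover obtain \<delta> where "\<delta> > 0" "\<forall>u\<in>nbh \<delta>. x + u \<in> W"
      using bspec[OF W, of x] x by auto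
    moreover have "nbh (min \<epsilon> \<delta>) \<subseteq> nbh \<epsilon>" "nbh (min \<epsilon> \<delta>) \<subseteq> nbh \<delta>" by (auto intro!: nbh_mono)
    ultimately show "\<exists>\<epsilon>>0. \<forall>u\<in>nbh \<epsilon>. x + u \<in> V \<inter> W"
      by (intro exI[of _ "min \<epsilon> \<delta>"]) auto
  next
    fix \<V> x
    assume open_V: "\<forall>V\<in>\<V>. \<forall>x\<in>V. \<exists>\<epsilon>>0. \<forall>u\<in>nbh \<epsilon>. x + u \<in> V" and "x \<in> \<Union>\<V>"
    then obtain V where V: "V \<in> \<V>" "x \<in> V" by blast
    then obtain \<epsilon> where "\<epsilon> > 0" "\<forall>u\<in>nbh \<epsilon>. x + u \<in> V"
      using bspec[OF bspec[OF open_V V(1)] V(2)] by auto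
    then show "\<exists>\<epsilon>>0. \<forall>u\<in>nbh \<epsilon>. x + u \<in> \<Union>\<V>"
      using V(1) by (intro exI[of _ \<epsilon>]) auto
  qed
  then show ?thesis unfolding ext_top_def by (simp add: topology_inverse')
qed

lemma topspace_ext_top [simp]: "topspace ext_top = UNIV"
proof -
  have "openin ext_top UNIV" unfolding openin_ext_top using zero_less_one by blast
  then show ?thesis using openin_subset by blast
qed

text \<open>By \<open>nbh_interior\<close> the basic neighbourhoods are themselves open, so they can
  serve directly as witnesses for separation, continuity of addition and the embedding.\<close>

lemma openin_translate_nbh: "openin ext_top ((+) x ` nbh \<epsilon>)"
  unfolding openin_ext_top
proof
  fix y assume "y \<in> (+) x ` nbh \<epsilon>"
  then obtain u where "u \<in> nbh \<epsilon>" and y: "y = x + u" by blast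
  then obtain \<delta> where "\<delta> > 0" "\<forall>v\<in>nbh \<delta>. u + v \<in> nbh \<epsilon>" using nbh_interior by blast
  then show "\<exists>\<delta>>0. \<forall>v\<in>nbh \<delta>. y + v \<in> (+) x ` nbh \<epsilon>"
    by (intro exI[of _ \<delta>]) (auto simp: y add.assoc)
qed

lemma in_translate_nbh: "0 < \<epsilon> \<Longrightarrow> x \<in> (+) x ` nbh \<epsilon>"
  using zero_in_nbh[of \<epsilon>] by (force intro: image_eqI[of _ _ 0])

lemma Hausdorff_ext_top: "Hausdorff_space ext_top"
  unfolding Hausdorff_space_def
proof (intro allI impI)
  fix x y :: "real \<times> int" assume "x \<in> topspace ext_top \<and> y \<in> topspace ext_top \<and> x \<noteq> y"
  then have "x - y \<noteq> 0" by simp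
  then obtain \<epsilon> where \<epsilon>: "\<epsilon> > 0" "\<And>u v. u \<in> nbh \<epsilon> \<Longrightarrow> v \<in> nbh \<epsilon> \<Longrightarrow> x - y \<noteq> u - v"
    using nbh_separates by blast
  have "disjnt ((+) x ` nbh \<epsilon>) ((+) y ` nbh \<epsilon>)"
  proof -
    have False if "u \<in> nbh \<epsilon>" "v \<in> nbh \<epsilon>" "x + u = y + v" for u v
      using \<epsilon>(2)[OF that(2,1)] that(3) by (simp add: algebra_simps)
    then show ?thesis unfolding disjnt_def by blast
  qed
  then show "\<exists>U V. openin ext_top U \<and> openin ext_top V \<and> x \<in> U \<and> y \<in> V \<and> disjnt U V"
    using openin_translate_nbh in_translate_nbh[OF \<epsilon>(1)]
    by (intro exI[of _ "(+) x ` nbh \<epsilon>"] exI[of _ "(+) y ` nbh \<epsilon>"]) simp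
qed

lemma paratopological_group_ext: "paratopological_group ext_group ext_top"
proof -
  have "group ext_group"
    unfolding ext_group_def by (rule groupI) (auto simp: add.assoc simp del: split_paired_Ex intro: exI[of _ "- x" for x])
  moreover have "continuous_map (prod_topology ext_top ext_top) ext_top (\<lambda>(x, y). x + y)"
    unfolding continuous_map_def
  proof (intro conjI allI impI)
    fix U assume U: "openin ext_top U"
    show "openin (prod_topology ext_top ext_top)
            {p \<in> topspace (prod_topology ext_top ext_top). (case p of (x, y) \<Rightarrow> x + y) \<in> U}"
      unfolding openin_prod_topology_alt
    proof (intro allI impI)
      fix x y
      assume "(x, y) \<in> {p \<in> topspace (prod_topology ext_top ext_top).
                          (case p of (x, y) \<Rightarrow> x + y) \<in> U}"
      then obtain \<epsilon> where \<epsilon>: "\<epsilon> > 0" "\<forall>u\<in>nbh \<epsilon>. (x + y) + u \<in> U"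
        using U unfolding openin_ext_top by auto
      \<comment> \<open>The budget is split evenly between the summands; commutativity collects
        \<open>u\<close> and \<open>v\<close> into one cheap element.\<close>
      have "(x + u) + (y + v) \<in> U" if "u \<in> nbh (\<epsilon>/2)" "v \<in> nbh (\<epsilon>/2)" for u v
        proof -
        have "u + v \<in> nbh \<epsilon>" using nbh_add[OF that] by simp
        then have "(x + y) + (u + v) \<in> U" using \<epsilon>(2) by blast
        then show ?thesis by (simp add: algebra_simps)
      qed
      then show "\<exists>A B. openin ext_top A \<and> openin ext_top B \<and> x \<in> A \<and> y \<in> B \<and>
          A \<times> B \<subseteq> {p \<in> topspace (prod_topology ext_top ext_top). (case p of (x, y) \<Rightarrow> x + y) \<in> U}"
        using \<epsilon>(1) in_translate_nbh[of "\<epsilon>/2"] openin_translate_nbh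
        by (intro exI[of _ "(+) x ` nbh (\<epsilon>/2)"] exI[of _ "(+) y ` nbh (\<epsilon>/2)"]) auto
    qed
  qed auto
  ultimately show ?thesis
    by (simp add: paratopological_group_def ext_group_def)
qed

section \<open>The line as a subgroup that is not closed\<close>

lemma embedding_map_ext: "embedding_map sorgenfrey ext_top (\<lambda>t. (t, 0))"
proof -
  let ?e = "\<lambda>t :: real. (t, 0 :: int)"
  have "continuous_map sorgenfrey ext_top ?e"
    unfolding continuous_map_def
  proof (intro conjI allI impI)
    fix V assume V: "openin ext_top V"
    show "openin sorgenfrey {t \<in> topspace sorgenfrey. ?e t \<in> V}"
      unfolding openin_sorgenfrey_iff
    proof
      fix t assume "t \<in> {t \<in> topspace sorgenfrey. ?e t \<in> V}"
      then obtain \<epsilon> where \<epsilon>: "\<epsilon> > 0" "\<forall>u\<in>nbh \<epsilon>. ?e t + u \<in> V"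
        using V unfolding openin_ext_top by auto
      have "?e r \<in> V" if "r \<in> {t..<t + \<epsilon>}" for r
        using \<epsilon>(2)[rule_format, of "?e (r - t)"] that by (simp add: nbh_level_zero)
      then show "\<exists>y>t. {t..<y} \<subseteq> {t \<in> topspace sorgenfrey. ?e t \<in> V}"
        using \<epsilon>(1) by (intro exI[of _ "t + \<epsilon>"]) auto
    qed
  qed auto
  then have cont: "continuous_map sorgenfrey (subtopology ext_top (range ?e)) ?e"
    by (simp add: continuous_map_in_subtopology)
  have "open_map sorgenfrey (subtopology ext_top (range ?e)) ?e"
    unfolding open_map_def
  proof (intro allI impI)
    fix A assume "openin sorgenfrey A"
    then obtain b where b: "\<And>t. t \<in> A \<Longrightarrow> t < b t \<and> {t..<b t} \<subseteq> A"
      unfolding openin_sorgenfrey_iff by metis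
    \<comment> \<open>The radius \<open>b t - t\<close> makes each translate meet the line exactly
      in \<open>{t..<b t}\<close>, which lies inside \<open>A\<close>.\<close>
    define V where "V = (\<Union>t\<in>A. (+) (?e t) ` nbh (b t - t))"
    have "openin ext_top V" unfolding V_def by (auto intro: openin_translate_nbh)
    moreover have "?e ` A = V \<inter> range ?e"
    proof
      show "?e ` A \<subseteq> V \<inter> range ?e"
      proof
        fix p assume "p \<in> ?e ` A"
        then obtain t where t: "t \<in> A" "p = ?e t" by blast
        then have "p \<in> (+) (?e t) ` nbh (b t - t)" using b[of t] by (simp add: in_translate_nbh)
        then show "p \<in> V \<inter> range ?e" using t unfolding V_def by blast
      qed
      show "V \<inter> range ?e \<subseteq> ?e ` A"
      proof
        fix p assume p: "p \<in> V \<inter> range ?e"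
        then obtain r where r: "p = ?e r" by blast
        from p obtain t u where t: "t \<in> A" "u \<in> nbh (b t - t)" "p = ?e t + u"
          unfolding V_def by blast
        then have "u = ?e (r - t)" using r by (cases u) auto
        then have "r \<in> {t..<b t}" using t(2) by (simp add: nbh_level_zero)
        then show "p \<in> ?e ` A" using b[OF t(1)] r by blast
      qed
    qed
    ultimately show "openin (subtopology ext_top (range ?e)) (?e ` A)"
      unfolding openin_subtopology by blast
  qed
  with cont show ?thesis
    unfolding embedding_map_def topspace_sorgenfrey
    by (intro bijective_open_imp_homeomorphic_map) (auto simp: inj_on_def)
qed

lemma not_closedin_ext: "\<not> closedin ext_top (range (\<lambda>t. (t, 0)))"
proof
  let ?R = "range (\<lambda>t :: real. (t, 0 :: int))"
  assume "closedin ext_top ?R"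
  then have "openin ext_top (- ?R)" by (simp add: closedin_def Compl_eq_Diff_UNIV)
  moreover have "(0, -1) \<in> - ?R" by auto
  ultimately obtain \<epsilon> where \<epsilon>: "\<epsilon> > 0" "\<forall>u\<in>nbh \<epsilon>. (0, -1) + u \<in> - ?R"
    unfolding openin_ext_top by blast
  \<comment> \<open>A cheap enough spike raises \<open>(0, -1)\<close> to level 0, that is, into the
    line, so no neighbourhood of this point avoids the line.\<close>
  obtain m where "(1/2) ^ m < \<epsilon>" using real_arch_pow_inv[of \<epsilon> "1/2"] \<epsilon>(1) by auto
  then have "(0, -1) + (real (spike m), 1) \<in> - ?R" using \<epsilon>(2) spike_in_nbh by blast
  then show False by simp
qed

theorem theorem6p2:
  shows "\<not> H_closed real_add_group sorgenfrey"
proof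
  assume "H_closed real_add_group sorgenfrey"
  moreover have "paratopological_embedding real_add_group sorgenfrey ext_group ext_top (\<lambda>t. (t, 0))"
    using embedding_map_ext
    by (auto simp: paratopological_embedding_def hom_def real_add_group_def ext_group_def)
  \<comment> \<open>\<open>H_closed\<close> itself speaks only of groups on words;
    \<open>H_closed_closedin\<close> carries it over to the type
    \<open>real \<times> int\<close>.\<close>
  ultimately have "closedin ext_top ((\<lambda>t. (t, 0)) ` carrier real_add_group)"
    using H_closed_closedin paratopological_group_sorgenfrey paratopological_group_ext
      Hausdorff_ext_top by blast
  then show False using not_closedin_ext by (simp add: real_add_group_def)
qed

end
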